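(* Let $L_{pal}=\{w\in\{a,b\}^*\mid w=w^R\}$, where $w^R$ is the reverse of $w$. For every $\epsilon>0$ there exists a 15-state one-way quantum finite automaton with restart $\mathcal{M}_\epsilon$ which accepts every $w\in L_{pal}$ with probability 1 and rejects every $w\in\{a,b\}^*\setminus L_{pal}$ with probability at least $1-\epsilon$. Moreover, the expected runtime of $\mathcal{M}_\epsilon$ on input $w$ is $O\big(\frac1\epsilon3^{|w|}|w|\big)$.
   Context: Let $\vdash,\dashv$ be end-markers, $\Sigma=\{a,b\}$, $\Gamma=\Sigma\cup\{\vdash,\dashv\}$. A one-way quantum finite automaton with restart over $\Sigma$ consists of a finite state set $Q$ partitioned into disjoint sets $Q_{non}$ (nonhalting), $Q_{acc}$, $Q_{rej}$, $Q_{restart}$, an initial state $q_0\in Q_{non}$, and for each $\sigma\in\Gamma$ a unitary operator $U_\sigma$ on the space with orthonormal basis $\{|q\rangle:q\in Q\}$. On input $w$ the tape contains $\vdash w\dashv$. A round starts in $|q_0\rangle$ with the head on $\vdash$; symbols are read left to right; on each symbol $\sigma$ the machine applies $U_\sigma$ and then performs the projective measurement onto the spans of $Q_{acc},Q_{rej},Q_{non},Q_{restart}$: "accept"/"reject" halt with that answer, "nonhalting" continues with the normalized projection onto the span of $Q_{non}$ on the next symbol, "restart" begins a new round from $|q_0\rangle$ on $\vdash$. Each round ends in halting or restarting with probability 1. Acceptance/rejection probabilities are those of eventually accepting/rejecting over all rounds; runtime counts all steps of all rounds. *)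

theory Defs
  imports "HOL-Probability.Probability"
begin

datatype letter = LetA | LetB

datatype tape_symbol = LeftEnd | Letter letter | RightEnd

definition tape :: "letter list \<Rightarrow> tape_symbol list" where
  "tape w = LeftEnd # map Letter w @ [RightEnd]"

definition L_pal :: "letter list set" where
  "L_pal = {w. w = rev w}"

datatype outcome = Accept | Reject | Nonhalting | Restart

(* The state set is the finite type 'q, so that an n-state automaton is one with CARD('q) = n.
   The field kind encodes the partition of the states: Q_acc = {q. kind M q = Accept}, etc.
   Column q of op M s is the image of the basis vector |q> under U_s. *)
record ('q::finite) qfa_restart =
  kind :: "'q \<Rightarrow> outcome"
  start :: 'q
  op :: "tape_symbol \<Rightarrow> complex ^ 'q ^ 'q"

definition conj_transpose :: "complex ^ 'm ^ 'n \<Rightarrow> complex ^ 'n ^ 'm" where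
  "conj_transpose A = (\<chi> i j. cnj (A $ j $ i))"

definition unitary :: "complex ^ 'n ^ 'n \<Rightarrow> bool" where
  "unitary A \<longleftrightarrow> conj_transpose A ** A = mat 1 \<and> A ** conj_transpose A = mat 1"

definition basis_state :: "'q::finite \<Rightarrow> complex ^ 'q" where
  "basis_state q = axis q 1"

definition proj :: "('q::finite) qfa_restart \<Rightarrow> outcome \<Rightarrow> complex ^ 'q \<Rightarrow> complex ^ 'q" where
  "proj M r \<psi> = (\<chi> q. if kind M q = r then \<psi> $ q else 0)"

(* Born rule. The numbers on the right sum to 1 whenever norm \<psi> = 1 (see pmf_measurement below),
   and only unit vectors are ever measured by a machine with unitary operators. *)
definition measurement :: "('q::finite) qfa_restart \<Rightarrow> complex ^ 'q \<Rightarrow> outcome pmf" where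
  "measurement M \<psi> = embed_pmf (\<lambda>r. (norm (proj M r \<psi>))\<^sup>2)"

lemma UNIV_outcome: "UNIV = {Accept, Reject, Nonhalting, Restart}"
  by (auto intro: outcome.exhaust)

lemma sum_norm_proj:
  "(\<Sum>r\<in>UNIV. (norm (proj M r \<psi>))\<^sup>2) = (norm \<psi>)\<^sup>2"
proof -
  have "(norm (proj M r \<psi>))\<^sup>2 = (\<Sum>q\<in>UNIV. if kind M q = r then (norm (\<psi> $ q))\<^sup>2 else 0)" for r
    unfolding norm_vec_def L2_set_def proj_def
    by (simp add: sum_nonneg if_distrib [of norm] if_distrib [of "\<lambda>x. x\<^sup>2"] cong: if_cong)
  moreover have "(norm \<psi>)\<^sup>2 = (\<Sum>q\<in>UNIV. (norm (\<psi> $ q))\<^sup>2)"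
    unfolding norm_vec_def L2_set_def by (simp add: sum_nonneg)
  moreover have "finite (UNIV :: outcome set)"
    by (simp add: UNIV_outcome)
  ultimately show ?thesis
    by (simp add: sum.swap [of _ "UNIV :: 'a set"])
qed

lemma pmf_measurement:
  assumes "norm \<psi> = 1"
  shows "pmf (measurement M \<psi>) r = (norm (proj M r \<psi>))\<^sup>2"
  unfolding measurement_def
proof (rule pmf_embed_pmf)
  have "finite (UNIV :: outcome set)"
    by (simp add: UNIV_outcome)
  then show "(\<integral>\<^sup>+ r. ennreal ((norm (proj M r \<psi>))\<^sup>2) \<partial>count_space UNIV) = 1"
    by (simp add: nn_integral_count_space_finite sum_ennreal sum_norm_proj assms)
qed simp

(* Running \<psi> ts: current (normalized) state vector and the part of the tape not yet read. *)
datatype 'q config =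
    Running "complex ^ 'q" "tape_symbol list"
  | Accepted
  | Rejected

definition initial_config :: "('q::finite) qfa_restart \<Rightarrow> letter list \<Rightarrow> 'q config" where
  "initial_config M w = Running (basis_state (start M)) (tape w)"

(* One step on input w. Having read the whole tape without halting or restarting, the machine is
   stuck; rounds_end below excludes this. *)
fun step :: "('q::finite) qfa_restart \<Rightarrow> letter list \<Rightarrow> 'q config \<Rightarrow> 'q config pmf" where
  "step M w (Running \<psi> (s # ts)) =
     map_pmf
       (\<lambda>r. case r of
          Accept \<Rightarrow> Accepted
        | Reject \<Rightarrow> Rejected
        | Nonhalting \<Rightarrow>
            (let \<phi> = proj M Nonhalting (op M s *v \<psi>) in Running (\<phi> /\<^sub>R norm \<phi>) ts)
        | Restart \<Rightarrow> initial_config M w)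
       (measurement M (op M s *v \<psi>))"
| "step M w (Running \<psi> []) = return_pmf (Running \<psi> [])"
| "step M w Accepted = return_pmf Accepted"
| "step M w Rejected = return_pmf Rejected"

fun config_after :: "('q::finite) qfa_restart \<Rightarrow> letter list \<Rightarrow> nat \<Rightarrow> 'q config pmf" where
  "config_after M w 0 = return_pmf (initial_config M w)"
| "config_after M w (Suc n) = bind_pmf (config_after M w n) (step M w)"

definition rounds_end :: "('q::finite) qfa_restart \<Rightarrow> bool" where
  "rounds_end M \<longleftrightarrow> (\<forall>w n \<psi>. Running \<psi> [] \<notin> set_pmf (config_after M w n))"

definition valid_qfa :: "('q::finite) qfa_restart \<Rightarrow> bool" where
  "valid_qfa M \<longleftrightarrow>
     kind M (start M) = Nonhalting \<and> (\<forall>s. unitary (op M s)) \<and> rounds_end M"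

(* Accepted and Rejected are absorbing, so these suprema are limits of increasing sequences. *)
definition accept_prob :: "('q::finite) qfa_restart \<Rightarrow> letter list \<Rightarrow> real" where
  "accept_prob M w = (SUP n. pmf (config_after M w n) Accepted)"

definition reject_prob :: "('q::finite) qfa_restart \<Rightarrow> letter list \<Rightarrow> real" where
  "reject_prob M w = (SUP n. pmf (config_after M w n) Rejected)"

definition halted_by :: "('q::finite) qfa_restart \<Rightarrow> letter list \<Rightarrow> nat \<Rightarrow> real" where
  "halted_by M w n = measure_pmf.prob (config_after M w n) {Accepted, Rejected}"

(* The sum of n * P(runtime = n) over all n \<ge> 1 (nothing halts after 0 steps), where the runtime
   is infinite on computations that never halt. *)
definition expected_runtime :: "('q::finite) qfa_restart \<Rightarrow> letter list \<Rightarrow> ennreal" where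
  "expected_runtime M w =
     (if (SUP n. halted_by M w n) < 1 then \<infinity>
      else (\<Sum>n. ennreal (real (Suc n) * (halted_by M w (Suc n) - halted_by M w n))))"

end

theory Submission
  imports Defs
begin

text \<open>Let \<open>\<theta> = 1 + \<surd>-2\<close> and assign to the two letters the symmetric matrices \<open>diag(\<theta>, 2 - \<theta>)\<close> and
  \<open>((1, \<surd>-2), (\<surd>-2, 1))\<close>, which are \<open>\<surd>3\<close> times unitary matrices. By symmetry, the product \<open>X\<close> of the
  letters of \<open>w\<close> is transposed when \<open>w\<close> is reversed, so \<open>d = X\<^sub>1\<^sub>2 - X\<^sub>2\<^sub>1\<close> vanishes for palindromes. If
  \<open>w\<close> is not a palindrome, then \<open>\<bar>d\<bar> \<ge> 1\<close>: removing equal letters at both ends divides \<open>d\<close> by their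
  determinant 3, and if the ends differ then \<open>d\<close> is nonzero modulo \<open>\<theta>\<close>, where both matrices have rank
  one. A round computes \<open>X / \<surd>3\<^sup>n\<close> in its amplitudes and rejects with probability proportional to
  \<open>\<bar>d\<bar>\<^sup>2 / 3\<^sup>n\<close>; a separate branch accepts with probability \<open>\<delta> / 3\<^sup>n\<close>, where \<open>\<delta>\<close> is of order \<open>\<epsilon>\<close>.\<close>

section \<open>Unitary matrices\<close>

lemma conj_transpose_nth [simp]: "conj_transpose A $ i $ j = cnj (A $ j $ i)"
  by (simp add: conj_transpose_def)

lemma conj_transpose_mult: "conj_transpose (A ** B) = conj_transpose B ** conj_transpose A"
  by (simp add: vec_eq_iff matrix_matrix_mult_def mult.commute)

lemma unitaryI: "conj_transpose A ** A = mat 1 \<Longrightarrow> unitary A"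
  by (simp add: unitary_def matrix_left_right_inverse)

lemma unitary_mult:
  assumes "unitary A" "unitary B"
  shows "unitary (A ** B)"
proof (rule unitaryI)
  have "conj_transpose (A ** B) ** (A ** B) = conj_transpose B ** (conj_transpose A ** A) ** B"
    by (simp add: conj_transpose_mult matrix_mul_assoc)
  with assms show "conj_transpose (A ** B) ** (A ** B) = mat 1"
    by (simp add: unitary_def)
qed

text \<open>On complex vectors \<open>\<bullet>\<close> is the real part of the Hermitian product,
  so moving a factor to the other side conjugates it. This real inner product already determines the
  norm.\<close>

lemma inner_matrix_vector_mult:
  fixes A :: "complex ^ 'n ^ 'm"
  shows "(A *v x) \<bullet> y = x \<bullet> (conj_transpose A *v y)"
proof -
  have "(A *v x) \<bullet> y = (\<Sum>i\<in>UNIV. \<Sum>j\<in>UNIV. (A $ i $ j * x $ j) \<bullet> y $ i)"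
    by (simp add: inner_vec_def matrix_vector_mult_def inner_sum_left)
  also have "\<dots> = (\<Sum>j\<in>UNIV. \<Sum>i\<in>UNIV. (A $ i $ j * x $ j) \<bullet> y $ i)"
    by (rule sum.swap)
  also have "\<dots> = (\<Sum>j\<in>UNIV. \<Sum>i\<in>UNIV. x $ j \<bullet> (cnj (A $ i $ j) * y $ i))"
    by (simp add: inner_complex_def algebra_simps)
  also have "\<dots> = x \<bullet> (conj_transpose A *v y)"
    by (simp add: inner_vec_def matrix_vector_mult_def inner_sum_right)
  finally show ?thesis .
qed

lemma norm_unitary:
  assumes "unitary A"
  shows "norm (A *v x) = norm x"
proof -
  have "(A *v x) \<bullet> (A *v x) = x \<bullet> ((conj_transpose A ** A) *v x)"
    by (simp add: inner_matrix_vector_mult matrix_vector_mul_assoc)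
  with assms show ?thesis
    by (simp add: unitary_def norm_eq_sqrt_inner)
qed

text \<open>Building operators as products of such blocks reduces unitarity in dimension 15 to
  unitarity of 2 x 2 matrices, with no completion of partial isometries.\<close>

definition embed2 :: "'n \<Rightarrow> 'n \<Rightarrow> complex ^ 2 ^ 2 \<Rightarrow> complex ^ 'n ^ 'n" where
  "embed2 i j B = (\<chi> k l.
     if k = i then (if l = i then B $ 1 $ 1 else if l = j then B $ 1 $ 2 else 0)
     else if k = j then (if l = i then B $ 2 $ 1 else if l = j then B $ 2 $ 2 else 0)
     else if k = l then 1 else 0)"

lemma embed2_mult_vec:
  assumes "i \<noteq> j"
  shows "embed2 i j B *v x = (\<chi> k.
     if k = i then B $ 1 $ 1 * x $ i + B $ 1 $ 2 * x $ j
     else if k = j then B $ 2 $ 1 * x $ i + B $ 2 $ 2 * x $ j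
     else x $ k)"
proof -
  have two: "(\<Sum>l\<in>UNIV. (if l = i then a else if l = j then b else 0) * x $ l)
      = a * x $ i + b * x $ j" for a b
  proof -
    have "(\<Sum>l\<in>UNIV. (if l = i then a else if l = j then b else 0) * x $ l)
        = (\<Sum>l\<in>UNIV. (if l = i then a * x $ i else 0) + (if l = j then b * x $ j else 0))"
      using assms by (intro sum.cong) auto
    then show ?thesis
      by (simp add: sum.distrib)
  qed
  have one: "(\<Sum>l\<in>UNIV. (if k = l then 1 else 0) * x $ l) = x $ k" for k
    by (simp add: if_distrib [of "\<lambda>a. a * _"] cong: if_cong)
  show ?thesis
    by (auto simp: vec_eq_iff matrix_vector_mult_def embed2_def two one)
qed

lemma conj_transpose_embed2:
  "i \<noteq> j \<Longrightarrow> conj_transpose (embed2 i j B) = embed2 i j (conj_transpose B)"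
  by (auto simp: vec_eq_iff embed2_def)

lemma embed2_mult: "i \<noteq> j \<Longrightarrow> embed2 i j A ** embed2 i j B = embed2 i j (A ** B)"
  unfolding matrix_eq matrix_vector_mul_assoc [symmetric]
  by (auto simp: embed2_mult_vec vec_eq_iff matrix_matrix_mult_def sum_2 algebra_simps)

lemma embed2_mat_1: "i \<noteq> j \<Longrightarrow> embed2 i j (mat 1) = mat 1"
  unfolding matrix_eq
  by (auto simp: embed2_mult_vec vec_eq_iff mat_def [where 'n = 2])

lemma unitary_embed2: "i \<noteq> j \<Longrightarrow> unitary B \<Longrightarrow> unitary (embed2 i j B)"
  by (rule unitaryI) (simp add: conj_transpose_embed2 embed2_mult embed2_mat_1 unitary_def)

definition rotation :: "real \<Rightarrow> real \<Rightarrow> complex ^ 2 ^ 2" where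
  "rotation x y = vector [vector [of_real x, - of_real y], vector [of_real y, of_real x]]"

lemma rotation_nth [simp]:
  "rotation x y $ 1 $ 1 = of_real x" "rotation x y $ 1 $ 2 = - of_real y"
  "rotation x y $ 2 $ 1 = of_real y" "rotation x y $ 2 $ 2 = of_real x"
  by (simp_all add: rotation_def)

lemma unitary_rotation:
  assumes "x\<^sup>2 + y\<^sup>2 = 1"
  shows "unitary (rotation x y)"
proof (rule unitaryI)
  have "complex_of_real x * of_real x + of_real y * of_real y = of_real (x\<^sup>2 + y\<^sup>2)"
    by (simp add: power2_eq_square)
  with assms show "conj_transpose (rotation x y) ** rotation x y = mat 1"
    by (simp add: vec_eq_iff matrix_matrix_mult_def sum_2 forall_2 mat_def add.commute)
qed

section \<open>Separating a word from its reversal\<close>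

abbreviation root_minus_two :: complex where
  "root_minus_two \<equiv> \<i> * complex_of_real (sqrt 2)"

lemma sqrt_two_square: "complex_of_real (sqrt 2) * complex_of_real (sqrt 2) = 2"
  by (simp flip: of_real_mult)

lemma root_minus_two_square: "root_minus_two * root_minus_two = - 2"
  using sqrt_two_square by (simp add: algebra_simps)

fun letter_matrix :: "letter \<Rightarrow> complex ^ 2 ^ 2" where
  "letter_matrix LetA = vector [vector [1 + root_minus_two, 0], vector [0, 1 - root_minus_two]]"
| "letter_matrix LetB = vector [vector [1, root_minus_two], vector [root_minus_two, 1]]"

lemma transpose_letter_matrix: "transpose (letter_matrix c) = letter_matrix c"
  by (cases c) (simp_all add: vec_eq_iff transpose_def forall_2)

text \<open>Every column has squared norm 3. The columns for \<open>LetB\<close> are orthogonal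
  because one off-diagonal entry enters conjugated, the other not, and both are the same imaginary
  number.\<close>

lemma letter_matrix_unitary: "unitary ((1 / sqrt 3) *\<^sub>R letter_matrix c)"
proof (rule unitaryI)
  have 3: "complex_of_real (sqrt 3) * complex_of_real (sqrt 3) = 3"
    by (simp flip: of_real_mult)
  show "conj_transpose ((1 / sqrt 3) *\<^sub>R letter_matrix c) ** ((1 / sqrt 3) *\<^sub>R letter_matrix c) = mat 1"
    using 3 root_minus_two_square
    by (cases c) (auto simp: vec_eq_iff matrix_matrix_mult_def sum_2 forall_2 mat_def
        scaleR_conv_of_real [where 'a = complex] field_simps)
qed

text \<open>The first letter stands rightmost because operators act from the left in reading
  order.\<close>

fun word_matrix :: "letter list \<Rightarrow> complex ^ 2 ^ 2" where
  "word_matrix [] = mat 1"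
| "word_matrix (c # w) = word_matrix w ** letter_matrix c"

lemma word_matrix_singleton: "word_matrix [c] = letter_matrix c"
  by simp

lemma word_matrix_append: "word_matrix (u @ v) = word_matrix v ** word_matrix u"
  by (induction u) (simp_all add: matrix_mul_assoc)

lemma transpose_word_matrix: "transpose (word_matrix w) = word_matrix (rev w)"
  by (induction w) (simp_all add: word_matrix_append matrix_transpose_mul transpose_letter_matrix)

definition asymmetry :: "letter list \<Rightarrow> complex" where
  "asymmetry w = word_matrix w $ 1 $ 2 - word_matrix w $ 2 $ 1"

lemma asymmetry_palindrome: "w = rev w \<Longrightarrow> asymmetry w = 0"
  using transpose_word_matrix [of w] by (simp add: asymmetry_def transpose_def vec_eq_iff)

text \<open>For symmetric \<open>S\<close>, the antisymmetric part of \<open>S ** X ** S\<close> is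
  that of \<open>X\<close> multiplied by \<open>S\<close> on both sides. In dimension 2 this is a
  scaling by the determinant of \<open>S\<close>, which is 3 for both letters.\<close>

lemma asymmetry_same_ends: "asymmetry (c # w @ [c]) = 3 * asymmetry w"
proof -
  have two: "complex_of_real (sqrt 2) * (complex_of_real (sqrt 2) * z) = 2 * z" for z
    unfolding mult.assoc [symmetric] sqrt_two_square ..
  show ?thesis
    by (cases c)
      (simp_all add: asymmetry_def word_matrix_append matrix_matrix_mult_def sum_2 mat_def
        algebra_simps two)
qed

text \<open>The ring homomorphism from \<open>\<int>[\<surd>-2]\<close> to \<open>\<int>/3\<close> with kernel generated by \<open>1 + \<surd>-2\<close>,
  as a relation.\<close>

definition reduces :: "complex \<Rightarrow> int \<Rightarrow> bool" where
  "reduces z m \<longleftrightarrow> (\<exists>x y. z = of_int x + root_minus_two * of_int y \<and> 3 dvd x - y - m)"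

lemma reduces_of_int: "reduces (of_int m) m"
  unfolding reduces_def by (intro exI [of _ m] exI [of _ 0]) simp

lemma reduces_root_minus_two: "reduces root_minus_two (- 1)"
  unfolding reduces_def by (intro exI [of _ 0] exI [of _ 1]) simp

lemma reduces_add:
  assumes "reduces z m" "reduces z' m'"
  shows "reduces (z + z') (m + m')"
proof -
  obtain x y x' y' where
    z: "z = of_int x + root_minus_two * of_int y" "3 dvd x - y - m" and
    z': "z' = of_int x' + root_minus_two * of_int y'" "3 dvd x' - y' - m'"
    using assms unfolding reduces_def by blast
  have "3 dvd (x + x') - (y + y') - (m + m')"
    using dvd_add [OF z(2) z'(2)] by (simp add: algebra_simps)
  with z(1) z'(1) show ?thesis
    unfolding reduces_def
    by (intro exI [of _ "x + x'"] exI [of _ "y + y'"]) (simp add: algebra_simps)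
qed

lemma reduces_mult:
  assumes "reduces z m" "reduces z' m'"
  shows "reduces (z * z') (m * m')"
proof -
  obtain x y x' y' where
    z: "z = of_int x + root_minus_two * of_int y" "3 dvd x - y - m" and
    z': "z' = of_int x' + root_minus_two * of_int y'" "3 dvd x' - y' - m'"
    using assms unfolding reduces_def by blast
  \<comment> \<open>The image of the product differs from the product of the images by a multiple of
    3 because -2 is the square of -1 modulo 3.\<close>
  have eq: "x * x' - 2 * (y * y') - (x * y' + y * x') - m * m'
      = (x - y - m) * (x' - y') + m * (x' - y' - m') - 3 * (y * y')"
    by (simp add: algebra_simps)
  have "3 dvd x * x' - 2 * (y * y') - (x * y' + y * x') - m * m'"
    unfolding eq using z(2) z'(2) by (intro dvd_diff dvd_add) auto
  moreover have "z * z' = of_int (x * x' - 2 * (y * y')) + root_minus_two * of_int (x * y' + y * x')"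
  proof -
    have "z * z' = of_int (x * x') + (root_minus_two * root_minus_two) * of_int (y * y')
        + root_minus_two * of_int (x * y' + y * x')"
      by (simp add: z(1) z'(1) algebra_simps)
    then show ?thesis
      unfolding root_minus_two_square by simp
  qed
  ultimately show ?thesis
    unfolding reduces_def by blast
qed

lemma reduces_diff:
  assumes "reduces z m" "reduces z' m'"
  shows "reduces (z - z') (m - m')"
  using reduces_add [OF assms(1) reduces_mult [OF reduces_of_int [of "- 1"] assms(2)]] by simp

text \<open>The squared norm is the integer \<open>x\<^sup>2 + 2 * y\<^sup>2\<close>, and it
  vanishes only if \<open>x = y = 0\<close>, which would make \<open>m\<close> divisible by
  3.\<close>

lemma norm_ge_1_of_reduces:
  assumes "reduces z m" "\<not> 3 dvd m"
  shows "1 \<le> norm z"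
proof -
  obtain x y where z: "z = of_int x + root_minus_two * of_int y" "3 dvd x - y - m"
    using assms unfolding reduces_def by blast
  have "x \<noteq> 0 \<or> y \<noteq> 0"
    using z(2) assms(2) by auto
  then have "1 \<le> x\<^sup>2 + 2 * y\<^sup>2"
    by (smt (verit) zero_less_power2 zero_le_power2)
  moreover have "(norm z)\<^sup>2 = of_int (x\<^sup>2 + 2 * y\<^sup>2)"
    by (simp add: z(1) cmod_power2 power_mult_distrib)
  ultimately have "1 \<le> (norm z)\<^sup>2"
    by (simp only: of_int_1_le_iff)
  then show ?thesis
    using power2_le_imp_le [of 1 "norm z"] by simp
qed

text \<open>Modulo \<open>1 + \<surd>-2\<close>, the matrix of a letter \<open>c\<close> is \<open>\<plusminus> u u\<^sup>T\<close> for the vector \<open>u\<close> with entries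
  \<open>residue_vector c\<close>.\<close>

fun residue_vector :: "letter \<Rightarrow> 2 \<Rightarrow> int" where
  "residue_vector LetA i = (if i = 1 then 0 else 1)"
| "residue_vector LetB i = (if i = 1 then 1 else - 1)"

fun residue_sign :: "letter \<Rightarrow> int" where
  "residue_sign LetA = - 1"
| "residue_sign LetB = 1"

lemma reduces_cong: "reduces z m \<Longrightarrow> 3 dvd m - m' \<Longrightarrow> reduces z m'"
proof -
  assume "reduces z m" "3 dvd m - m'"
  moreover have "3 dvd x - y - m'" if "3 dvd x - y - m" "3 dvd m - m'" for x y
    using dvd_add [OF that] by (simp only: diff_add_cancel diff_diff_eq2 add_diff_eq)
  ultimately show ?thesis
    unfolding reduces_def by blast
qed

lemma reduces_letter_matrix:
  "reduces (letter_matrix c $ i $ j) (residue_sign c * residue_vector c i * residue_vector c j)"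
proof -
  note one = reduces_of_int [of 1, simplified]
  have "reduces (1 + root_minus_two) 0" "reduces (1 - root_minus_two) (- 1)"
    using reduces_add [OF one reduces_root_minus_two]
      reduces_cong [OF reduces_diff [OF one reduces_root_minus_two], of "- 1"] by simp_all
  moreover have "reduces 0 0"
    using reduces_of_int [of 0] by simp
  ultimately show ?thesis
    using one reduces_root_minus_two exhaust_2 [of i] exhaust_2 [of j]
    by (cases c) auto
qed

text \<open>A product of rank-one matrices keeps the left vector of its first factor and the right
  vector of its last. All other factors contribute scalars, which turn out to be units modulo
  3.\<close>

lemma reduces_word_matrix:
  "\<exists>m. \<not> 3 dvd m \<and> (\<forall>i j. reduces (word_matrix (w @ [c]) $ i $ j)
     (m * residue_vector c i * residue_vector (hd (w @ [c])) j))"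
proof (induction w arbitrary: c rule: rev_induct)
  case Nil
  have "\<not> 3 dvd residue_sign c"
    by (cases c) auto
  then show ?case
    using reduces_letter_matrix [of c] by (intro exI [of _ "residue_sign c"]) auto
next
  case (snoc b w)
  let ?f = "hd (w @ [b])"
  obtain m where m: "\<not> 3 dvd m"
    "\<And>i j. reduces (word_matrix (w @ [b]) $ i $ j) (m * residue_vector b i * residue_vector ?f j)"
    using snoc.IH [of b] by blast
  \<comment> \<open>Prepending the matrix of \<open>c\<close> contributes its sign and the inner
    product of the residue vectors of the neighbouring letters \<open>c\<close> and
    \<open>b\<close>.\<close>
  define k where "k = residue_sign c * (\<Sum>l\<in>UNIV. residue_vector c l * residue_vector b l)"
  have "k \<in> {- 1, 1, - 2, 2}"
    by (cases c; cases b) (auto simp: k_def sum_2)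
  then have "\<not> 3 dvd m * k"
    using m(1) by auto presburger+
  moreover have "reduces (word_matrix ((w @ [b]) @ [c]) $ i $ j)
      (m * k * residue_vector c i * residue_vector ?f j)" for i j
  proof -
    have "reduces (word_matrix ((w @ [b]) @ [c]) $ i $ j)
      ((residue_sign c * residue_vector c i * residue_vector c 1)
        * (m * residue_vector b 1 * residue_vector ?f j)
      + (residue_sign c * residue_vector c i * residue_vector c 2)
        * (m * residue_vector b 2 * residue_vector ?f j))"
      unfolding word_matrix_append [of "w @ [b]"] word_matrix_singleton
      by (simp add: matrix_matrix_mult_def sum_2 del: residue_vector.simps)
        (intro reduces_add reduces_mult reduces_letter_matrix m(2))
    then show ?thesis
      by (simp add: k_def sum_2 algebra_simps)
  qed
  moreover have "hd ((w @ [b]) @ [c]) = ?f"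
    by (cases w) auto
  ultimately show ?case
    by (intro exI [of _ "m * k"]) simp
qed

lemma norm_asymmetry_ge_1: "w \<noteq> rev w \<Longrightarrow> 1 \<le> norm (asymmetry w)"
proof (induction "length w" arbitrary: w rule: less_induct)
  case less
  obtain c v where w: "w = c # v"
    using less.prems by (cases w) auto
  \<comment> \<open>One-letter words are palindromes, so the two ends are distinct
    positions.\<close>
  obtain u e where v: "v = u @ [e]"
    using less.prems w by (cases v rule: rev_cases) auto
  show ?case
  proof (cases "c = e")
    case True
    with less.prems w v have "u \<noteq> rev u" by simp
    with less.hyps [of u] w v have "1 \<le> norm (asymmetry u)" by simp
    with True w v show ?thesis
      by (simp add: asymmetry_same_ends norm_mult)
  next
    case False
    obtain m where m: "\<not> 3 dvd m"
      "\<And>i j. reduces (word_matrix w $ i $ j) (m * residue_vector e i * residue_vector c j)"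
      using reduces_word_matrix [of "c # u" e] w v by auto
    have "reduces (asymmetry w) (m * residue_vector e 1 * residue_vector c 2
        - m * residue_vector e 2 * residue_vector c 1)"
      unfolding asymmetry_def by (intro reduces_diff m(2))
    \<comment> \<open>The difference is \<open>m\<close> times the determinant of the two residue
      vectors, which is 1 or -1 for different letters.\<close>
    moreover have "\<not> 3 dvd m * residue_vector e 1 * residue_vector c 2
        - m * residue_vector e 2 * residue_vector c 1"
      using m(1) False by (cases e; cases c) auto
    ultimately show ?thesis
      by (rule norm_ge_1_of_reduces)
  qed
qed

section \<open>Automata with restart\<close>

lemma finite_UNIV_outcome: "finite (UNIV :: outcome set)"
  by (simp add: UNIV_outcome)

lemma finite_set_step: "finite (set_pmf (step M w c))"
proof (cases c)
  case (Running \<psi> ts)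
  have "finite (set_pmf (measurement M (op M s *v \<psi>)))" for s
    using finite_UNIV_outcome by (rule rev_finite_subset) simp
  then show ?thesis
    using Running by (cases ts) simp_all
qed simp_all

lemma finite_set_config_after: "finite (set_pmf (config_after M w n))"
  by (induction n) (simp_all add: finite_set_step)

text \<open>Finite supports give the tower rule for every real function, including ones unbounded on
  configurations, such as \<open>potential\<close> below.\<close>

lemma expectation_config_after_Suc:
  fixes h :: "'q::finite config \<Rightarrow> real"
  shows "measure_pmf.expectation (config_after M w (Suc n)) h =
    measure_pmf.expectation (config_after M w n) (\<lambda>c. measure_pmf.expectation (step M w c) h)"
proof -
  have "measure_pmf.expectation (config_after M w (Suc n)) h =
    (\<Sum>c\<in>set_pmf (config_after M w n).
      pmf (config_after M w n) c *\<^sub>R measure_pmf.expectation (step M w c) h)"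
    unfolding config_after.simps
    by (rule pmf_expectation_bind [OF finite_set_config_after finite_set_step order_refl])
  also have "\<dots> = measure_pmf.expectation (config_after M w n)
      (\<lambda>c. measure_pmf.expectation (step M w c) h)"
    by (rule integral_measure_pmf [symmetric]) (simp_all add: finite_set_config_after)
  finally show ?thesis .
qed

lemma integrable_config_after:
  fixes h :: "'q::finite config \<Rightarrow> real"
  shows "integrable (config_after M w n) h"
  by (rule integrable_measure_pmf_finite [OF finite_set_config_after])

fun halted :: "('q::finite) config \<Rightarrow> bool" where
  "halted (Running \<psi> ts) = False"
| "halted Accepted = True"
| "halted Rejected = True"

lemma proj_scaleR: "proj M r (a *\<^sub>R \<psi>) = a *\<^sub>R proj M r \<psi>"
  by (simp add: vec_eq_iff proj_def)

lemma proj_idem: "proj M r (proj M r \<psi>) = proj M r \<psi>"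
  by (simp add: vec_eq_iff proj_def)

lemma matrix_vector_mult_scaleR_right:
  fixes A :: "complex ^ 'n ^ 'm"
  shows "A *v (a *\<^sub>R x) = a *\<^sub>R (A *v x)"
  by (simp add: vec_eq_iff matrix_vector_mult_def scaleR_sum_right)

text \<open>The state is not normalized between steps, so for \<open>norm \<psi> \<noteq> 1\<close> this is the probability that
  a round ends with outcome \<open>r\<close>, weighted by \<open>(norm \<psi>)\<^sup>2\<close>.\<close>

fun round_prob :: "('q::finite) qfa_restart \<Rightarrow> outcome \<Rightarrow> complex ^ 'q \<Rightarrow> tape_symbol list \<Rightarrow> real" where
  "round_prob M r \<psi> [] = 0"
| "round_prob M r \<psi> (s # ts) =
     (norm (proj M r (op M s *v \<psi>)))\<^sup>2 + round_prob M r (proj M Nonhalting (op M s *v \<psi>)) ts"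

lemma round_prob_nonneg: "0 \<le> round_prob M r \<psi> ts"
  by (induction ts arbitrary: \<psi>) simp_all

lemma round_prob_scaleR: "round_prob M r (a *\<^sub>R \<psi>) ts = a\<^sup>2 * round_prob M r \<psi> ts"
  by (induction ts arbitrary: \<psi>)
    (simp_all add: matrix_vector_mult_scaleR_right proj_scaleR power_mult_distrib algebra_simps)

text \<open>\<open>round_ends\<close> is a linear condition on a single operator. It replaces
  \<open>rounds_end\<close>, which speaks of all reachable configurations.\<close>

locale proper_qfa =
  fixes M :: "('q::finite) qfa_restart"
  assumes start_nonhalting: "kind M (start M) = Nonhalting"
    and unitary_op: "unitary (op M s)"
    and round_ends: "proj M Nonhalting \<psi> = \<psi> \<Longrightarrow> proj M Nonhalting (op M RightEnd *v \<psi>) = 0"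
begin

text \<open>The invariant of reachable configurations: unit norm makes the Born rule applicable, and
  the pending right end-marker excludes being stuck.\<close>

fun wf_config :: "'q config \<Rightarrow> bool" where
  "wf_config (Running \<psi> ts) \<longleftrightarrow>
     norm \<psi> = 1 \<and> proj M Nonhalting \<psi> = \<psi> \<and> ts \<noteq> [] \<and> last ts = RightEnd"
| "wf_config Accepted \<longleftrightarrow> True"
| "wf_config Rejected \<longleftrightarrow> True"

lemma norm_op: "norm (op M s *v \<psi>) = norm \<psi>"
  by (rule norm_unitary [OF unitary_op])

lemma pmf_measurement_op:
  "norm \<psi> = 1 \<Longrightarrow> pmf (measurement M (op M s *v \<psi>)) r = (norm (proj M r (op M s *v \<psi>)))\<^sup>2"
  by (simp add: pmf_measurement norm_op)

lemma sum_outcomes: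
  "(norm (proj M Accept (op M s *v \<psi>)))\<^sup>2 + (norm (proj M Reject (op M s *v \<psi>)))\<^sup>2
    + (norm (proj M Nonhalting (op M s *v \<psi>)))\<^sup>2 + (norm (proj M Restart (op M s *v \<psi>)))\<^sup>2
    = (norm \<psi>)\<^sup>2"
  using sum_norm_proj [of M "op M s *v \<psi>"] by (simp add: UNIV_outcome norm_op)

text \<open>Unitary operators preserve the norm, so the mass absorbed during a round is at most the
  initial mass.\<close>

lemma round_prob_le:
  "round_prob M Accept \<psi> ts + round_prob M Reject \<psi> ts \<le> (norm \<psi>)\<^sup>2"
proof (induction ts arbitrary: \<psi>)
  case (Cons s ts)
  show ?case
    using Cons.IH [of "proj M Nonhalting (op M s *v \<psi>)"] sum_outcomes [of s \<psi>]
      zero_le_power2 [of "norm (proj M Restart (op M s *v \<psi>))"]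
    unfolding round_prob.simps by linarith
qed simp

lemma wf_initial: "wf_config (initial_config M w)"
proof -
  have "norm (basis_state (start M)) = 1"
    by (simp add: basis_state_def)
  moreover have "proj M Nonhalting (basis_state (start M)) = basis_state (start M)"
    using start_nonhalting by (auto simp: basis_state_def vec_eq_iff proj_def axis_def)
  ultimately show ?thesis
    by (simp add: initial_config_def tape_def)
qed

lemma wf_step:
  assumes "wf_config c" "c' \<in> set_pmf (step M w c)"
  shows "wf_config c'"
proof (cases c)
  case (Running \<psi> ts)
  with assms(1) obtain s ts' where ts: "ts = s # ts'"
    by (cases ts) auto
  let ?\<phi> = "op M s *v \<psi>"
  have \<psi>: "norm \<psi> = 1" "proj M Nonhalting \<psi> = \<psi>" and last: "last ts = RightEnd"
    using assms(1) Running by auto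
  have "wf_config (Running (proj M Nonhalting ?\<phi> /\<^sub>R norm (proj M Nonhalting ?\<phi>)) ts')"
    if "Nonhalting \<in> set_pmf (measurement M ?\<phi>)"
  proof -
    have nz: "proj M Nonhalting ?\<phi> \<noteq> 0"
      using that \<psi>(1) by (auto simp: set_pmf_iff pmf_measurement_op)
    \<comment> \<open>On the last symbol \<open>round_ends\<close> would make the nonhalting
      projection zero.\<close>
    then have "ts' \<noteq> []"
      using round_ends [OF \<psi>(2)] last ts by auto
    with nz last ts show ?thesis
      by (simp add: proj_scaleR proj_idem)
  qed
  then show ?thesis
    using assms(2) Running ts wf_initial
    by (auto simp: Let_def split: outcome.splits)
qed (use assms in auto)

lemma wf_config_after: "c \<in> set_pmf (config_after M w n) \<Longrightarrow> wf_config c"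
proof (induction n arbitrary: c)
  case 0
  then show ?case by (simp add: wf_initial)
next
  case (Suc n)
  then show ?case
    using wf_step by auto
qed

lemma valid: "valid_qfa M"
  using start_nonhalting unitary_op wf_config_after
  by (fastforce simp: valid_qfa_def rounds_end_def)

lemma expectation_mono:
  fixes h h' :: "'q config \<Rightarrow> real"
  assumes "\<And>c. wf_config c \<Longrightarrow> h c \<le> h' c"
  shows "measure_pmf.expectation (config_after M w n) h
    \<le> measure_pmf.expectation (config_after M w n) h'"
  using assms wf_config_after
  by (intro integral_mono_AE integrable_config_after) (auto simp: AE_measure_pmf_iff)

lemma expectation_step:
  fixes h :: "'q config \<Rightarrow> real"
  assumes "norm \<psi> = 1"
  shows "measure_pmf.expectation (step M w (Running \<psi> (s # ts))) h =
    (let \<phi> = op M s *v \<psi>; \<eta> = proj M Nonhalting \<phi> in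
      h Accepted * (norm (proj M Accept \<phi>))\<^sup>2 + h Rejected * (norm (proj M Reject \<phi>))\<^sup>2
      + h (Running (\<eta> /\<^sub>R norm \<eta>) ts) * (norm \<eta>)\<^sup>2
      + h (initial_config M w) * (norm (proj M Restart \<phi>))\<^sup>2)"
proof -
  have "measure_pmf.expectation (measurement M (op M s *v \<psi>)) f
      = (\<Sum>r\<in>UNIV. f r * pmf (measurement M (op M s *v \<psi>)) r)" for f :: "outcome \<Rightarrow> real"
    by (rule integral_measure_pmf_real [OF finite_UNIV_outcome]) simp
  then show ?thesis
    by (simp add: Let_def UNIV_outcome pmf_measurement_op assms)
qed

lemma round_prob_normalize:
  "round_prob M r (\<eta> /\<^sub>R norm \<eta>) ts * (norm \<eta>)\<^sup>2 = round_prob M r \<eta> ts"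
proof (cases "\<eta> = 0")
  \<comment> \<open>Here the normalized vector is 0 as well, since
    \<open>inverse 0 = 0\<close>.\<close>
  case True
  then show ?thesis
    using round_prob_scaleR [of M r 0 0 ts] by simp
qed (simp add: round_prob_scaleR power_inverse)

section \<open>A potential and a harmonic function on configurations\<close>

definition final_prob :: "outcome \<Rightarrow> letter list \<Rightarrow> real" where
  "final_prob r w = round_prob M r (basis_state (start M)) (tape w)"

definition halting_prob :: "letter list \<Rightarrow> real" where
  "halting_prob w = final_prob Accept w + final_prob Reject w"

abbreviation unfinished :: "complex ^ 'q \<Rightarrow> tape_symbol list \<Rightarrow> real" where
  "unfinished \<psi> ts \<equiv> 1 - (round_prob M Accept \<psi> ts + round_prob M Reject \<psi> ts)"

text \<open>The expected remaining runtime when every round is charged for the whole tape, even if it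
  restarts early.\<close>

fun potential :: "letter list \<Rightarrow> 'q config \<Rightarrow> real" where
  "potential w (Running \<psi> ts) =
     real (length ts) + unfinished \<psi> ts * (real (length w + 2) / halting_prob w)"
| "potential w Accepted = 0"
| "potential w Rejected = 0"

text \<open>The harmonic function of the chain: either the current round ends with \<open>r\<close>,
  or fresh independent rounds follow, whose geometric series sums to
  \<open>final_prob r w / halting_prob w\<close>.\<close>

fun eventual_prob :: "outcome \<Rightarrow> letter list \<Rightarrow> 'q config \<Rightarrow> real" where
  "eventual_prob r w (Running \<psi> ts) =
     round_prob M r \<psi> ts + unfinished \<psi> ts * (final_prob r w / halting_prob w)"
| "eventual_prob r w Accepted = (if r = Accept then 1 else 0)"
| "eventual_prob r w Rejected = (if r = Reject then 1 else 0)"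

lemma final_prob_nonneg: "0 \<le> final_prob r w"
  by (simp add: final_prob_def round_prob_nonneg)

lemma halting_prob_nonneg: "0 \<le> halting_prob w"
  by (simp add: halting_prob_def final_prob_nonneg)

lemma unfinished_nonneg: "norm \<psi> = 1 \<Longrightarrow> 0 \<le> unfinished \<psi> ts"
  using round_prob_le [of \<psi> ts] by simp

lemma potential_nonneg: "wf_config c \<Longrightarrow> 0 \<le> potential w c"
  by (cases c) (auto intro!: add_nonneg_nonneg mult_nonneg_nonneg divide_nonneg_nonneg
      halting_prob_nonneg unfinished_nonneg simp del: of_nat_add)

lemma eventual_prob_running_nonneg:
  "wf_config (Running \<psi> ts) \<Longrightarrow> 0 \<le> eventual_prob r w (Running \<psi> ts)"
  by (auto intro!: add_nonneg_nonneg mult_nonneg_nonneg divide_nonneg_nonneg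
      halting_prob_nonneg unfinished_nonneg final_prob_nonneg round_prob_nonneg)

context
  fixes w :: "letter list"
  assumes halting_pos: "0 < halting_prob w"
begin

text \<open>With tape length L and halting probability h of a round, L + (1 - h) L / h = L / h.
  Hence the value charged for a restart is that of the initial configuration.\<close>

lemma initial_values:
  "potential w (initial_config M w) = real (length w + 2) / halting_prob w"
  "eventual_prob r w (initial_config M w) = final_prob r w / halting_prob w"
proof -
  have "unfinished (basis_state (start M)) (tape w) = 1 - halting_prob w"
    by (simp add: halting_prob_def final_prob_def)
  moreover have "round_prob M r (basis_state (start M)) (tape w) = final_prob r w" for r
    by (simp add: final_prob_def)
  moreover have "length (tape w) = length w + 2"
    by (simp add: tape_def)
  ultimately show "potential w (initial_config M w) = real (length w + 2) / halting_prob w"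
    "eventual_prob r w (initial_config M w) = final_prob r w / halting_prob w"
    using halting_pos unfolding initial_config_def
    by (simp_all add: field_simps del: of_nat_add)
qed

text \<open>The \<open>unfinished\<close> mass is balanced over a step, while the term for the
  unread tape drops by at least one.\<close>

lemma potential_step:
  assumes "wf_config c"
  shows "measure_pmf.expectation (step M w c) (potential w)
    \<le> potential w c - (if halted c then 0 else 1)"
proof (cases c)
  case (Running \<psi> ts)
  with assms obtain s ts' where ts: "ts = s # ts'" and \<psi>: "norm \<psi> = 1"
    by (cases ts) auto
  let ?\<phi> = "op M s *v \<psi>"
  let ?\<eta> = "proj M Nonhalting ?\<phi>"
  define G where "G = real (length w + 2) / halting_prob w"
  have "potential w (Running (?\<eta> /\<^sub>R norm ?\<eta>) ts') * (norm ?\<eta>)\<^sup>2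
    = real (length ts') * (norm ?\<eta>)\<^sup>2 + ((norm ?\<eta>)\<^sup>2 -
      (round_prob M Accept (?\<eta> /\<^sub>R norm ?\<eta>) ts' * (norm ?\<eta>)\<^sup>2
        + round_prob M Reject (?\<eta> /\<^sub>R norm ?\<eta>) ts' * (norm ?\<eta>)\<^sup>2)) * G"
    by (simp add: G_def algebra_simps del: of_nat_add)
  also have "\<dots> = real (length ts') * (norm ?\<eta>)\<^sup>2
      + ((norm ?\<eta>)\<^sup>2 - (round_prob M Accept ?\<eta> ts' + round_prob M Reject ?\<eta> ts')) * G"
    by (simp only: round_prob_normalize)
  finally have "measure_pmf.expectation (step M w c) (potential w)
    = real (length ts') * (norm ?\<eta>)\<^sup>2
      + ((norm ?\<eta>)\<^sup>2 - (round_prob M Accept ?\<eta> ts' + round_prob M Reject ?\<eta> ts')) * G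
      + G * (norm (proj M Restart ?\<phi>))\<^sup>2"
    unfolding Running ts expectation_step [OF \<psi>]
    by (simp only: Let_def initial_values G_def potential.simps(2,3))
  also have "\<dots> = real (length ts') * (norm ?\<eta>)\<^sup>2
      + ((norm ?\<eta>)\<^sup>2 + (norm (proj M Restart ?\<phi>))\<^sup>2
        - (round_prob M Accept ?\<eta> ts' + round_prob M Reject ?\<eta> ts')) * G"
    by (simp add: algebra_simps)
  also have "(norm ?\<eta>)\<^sup>2 + (norm (proj M Restart ?\<phi>))\<^sup>2
        - (round_prob M Accept ?\<eta> ts' + round_prob M Reject ?\<eta> ts') = unfinished \<psi> ts"
    using sum_outcomes [of s \<psi>] \<psi> ts by simp
  \<comment> \<open>Branches that halt or restart drop the charge for the unread tape, hence only an
    inequality.\<close>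
  also have "real (length ts') * (norm ?\<eta>)\<^sup>2 \<le> real (length ts') * 1"
  proof (rule mult_left_mono)
    show "(norm ?\<eta>)\<^sup>2 \<le> 1"
      using sum_outcomes [of s \<psi>]
        zero_le_power2 [of "norm (proj M Accept (op M s *v \<psi>))"]
        zero_le_power2 [of "norm (proj M Reject (op M s *v \<psi>))"]
        zero_le_power2 [of "norm (proj M Restart (op M s *v \<psi>))"]
      unfolding \<psi> one_power2 by linarith
  qed simp
  finally show ?thesis
    by (simp add: Running ts G_def)
qed simp_all

text \<open>The mass balance of \<open>potential_step\<close> without a charge for tape, so equality
  holds.\<close>

lemma eventual_prob_step:
  assumes "wf_config c" and r: "r = Accept \<or> r = Reject"
  shows "measure_pmf.expectation (step M w c) (eventual_prob r w) = eventual_prob r w c"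
proof (cases c)
  case (Running \<psi> ts)
  with assms obtain s ts' where ts: "ts = s # ts'" and \<psi>: "norm \<psi> = 1"
    by (cases ts) auto
  let ?\<phi> = "op M s *v \<psi>"
  let ?\<eta> = "proj M Nonhalting ?\<phi>"
  define A where "A = final_prob r w / halting_prob w"
  have "eventual_prob r w (Running (?\<eta> /\<^sub>R norm ?\<eta>) ts') * (norm ?\<eta>)\<^sup>2
    = round_prob M r (?\<eta> /\<^sub>R norm ?\<eta>) ts' * (norm ?\<eta>)\<^sup>2 + ((norm ?\<eta>)\<^sup>2 -
      (round_prob M Accept (?\<eta> /\<^sub>R norm ?\<eta>) ts' * (norm ?\<eta>)\<^sup>2
        + round_prob M Reject (?\<eta> /\<^sub>R norm ?\<eta>) ts' * (norm ?\<eta>)\<^sup>2)) * A"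
    by (simp add: A_def algebra_simps)
  also have "\<dots> = round_prob M r ?\<eta> ts'
      + ((norm ?\<eta>)\<^sup>2 - (round_prob M Accept ?\<eta> ts' + round_prob M Reject ?\<eta> ts')) * A"
    by (simp only: round_prob_normalize)
  finally have "measure_pmf.expectation (step M w c) (eventual_prob r w)
    = round_prob M r \<psi> ts
      + ((norm ?\<eta>)\<^sup>2 + (norm (proj M Restart ?\<phi>))\<^sup>2
        - (round_prob M Accept ?\<eta> ts' + round_prob M Reject ?\<eta> ts')) * A"
    unfolding Running ts expectation_step [OF \<psi>] using r
    by (simp only: Let_def initial_values A_def eventual_prob.simps(2,3))
      (auto simp: algebra_simps)
  also have "(norm ?\<eta>)\<^sup>2 + (norm (proj M Restart ?\<phi>))\<^sup>2
        - (round_prob M Accept ?\<eta> ts' + round_prob M Reject ?\<eta> ts') = unfinished \<psi> ts"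
    using sum_outcomes [of s \<psi>] \<psi> ts by simp
  finally show ?thesis
    by (simp add: Running A_def)
qed simp_all

lemma expectation_eventual_prob:
  assumes "r = Accept \<or> r = Reject"
  shows "measure_pmf.expectation (config_after M w n) (eventual_prob r w)
    = final_prob r w / halting_prob w"
proof (induction n)
  case 0
  then show ?case by (simp add: initial_values)
next
  case (Suc n)
  have "measure_pmf.expectation (config_after M w (Suc n)) (eventual_prob r w)
    = measure_pmf.expectation (config_after M w n) (eventual_prob r w)"
    unfolding expectation_config_after_Suc using wf_config_after
    by (intro integral_cong_AE) (auto simp: AE_measure_pmf_iff eventual_prob_step [OF _ assms])
  with Suc.IH show ?case by simp
qed

text \<open>A Foster-Lyapunov bound: each step lowers the expected potential by at least the
  probability of not having halted yet.\<close>

lemma expectation_potential: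
  "measure_pmf.expectation (config_after M w n) (potential w) + (\<Sum>k<n. 1 - halted_by M w k)
    \<le> real (length w + 2) / halting_prob w"
proof (induction n)
  case 0
  then show ?case by (simp add: initial_values del: of_nat_add)
next
  case (Suc n)
  have h: "indicator {Accepted, Rejected} c = (if halted c then 1 else 0 :: real)" for c :: "'q config"
    by (cases c) auto
  have "measure_pmf.expectation (config_after M w (Suc n)) (potential w)
    \<le> measure_pmf.expectation (config_after M w n)
        (\<lambda>c. potential w c - (1 - indicator {Accepted, Rejected} c))"
    unfolding expectation_config_after_Suc h using potential_step
    by (intro expectation_mono) fastforce
  also have "\<dots> = measure_pmf.expectation (config_after M w n) (potential w)
      - (1 - halted_by M w n)"
    by (simp add: integrable_config_after halted_by_def)
  finally show ?case
    using Suc.IH by simp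
qed

section \<open>Almost sure halting, expected runtime and eventual outcomes\<close>

lemma sum_unhalted_le: "(\<Sum>k<n. 1 - halted_by M w k) \<le> real (length w + 2) / halting_prob w"
proof -
  have "0 \<le> measure_pmf.expectation (config_after M w n) (potential w)"
    using expectation_mono [of "\<lambda>_. 0" "potential w" w n] potential_nonneg by simp
  with expectation_potential [of n] show ?thesis by simp
qed

lemma incseq_prob_halting:
  assumes "\<forall>c\<in>S. halted c"
  shows "incseq (\<lambda>n. measure_pmf.prob (config_after M w n) S)"
proof (rule incseq_SucI)
  fix n
  have "indicator S c \<le> measure_pmf.prob (step M w c) S" for c
    using assms by (cases c) (auto simp: indicator_def)
  then have "measure_pmf.expectation (config_after M w n) (indicator S)
    \<le> measure_pmf.expectation (config_after M w n) (\<lambda>c. measure_pmf.prob (step M w c) S)"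
    using expectation_mono [of "indicator S" "\<lambda>c. measure_pmf.prob (step M w c) S" w n] by blast
  then show "measure_pmf.prob (config_after M w n) S \<le> measure_pmf.prob (config_after M w (Suc n)) S"
    using expectation_config_after_Suc [of M w n "indicator S"] by simp
qed

lemma incseq_halted_by: "incseq (halted_by M w)"
  using incseq_prob_halting [of "{Accepted, Rejected}"] by (simp add: halted_by_def [abs_def])

text \<open>The terms \<open>1 - halted_by M w n\<close> decrease and have bounded partial sums, so
  they are at most a constant over \<open>n\<close>.\<close>

lemma halted_by_tendsto: "halted_by M w \<longlonglongrightarrow> 1"
proof -
  define G where "G = real (length w + 2) / halting_prob w"
  have "1 - halted_by M w n \<le> G / real n" if "n > 0" for n
  proof -
    have "(\<Sum>k<n. 1 - halted_by M w n) \<le> (\<Sum>k<n. 1 - halted_by M w k)"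
      using incseq_halted_by by (intro sum_mono) (simp add: incseqD)
    also have "\<dots> \<le> G"
      unfolding G_def by (rule sum_unhalted_le)
    finally show ?thesis
      using that by (simp add: field_simps)
  qed
  then have "1 - G / real n \<le> halted_by M w n" if "n > 0" for n
    using that by (simp add: diff_le_eq add.commute)
  then have "eventually (\<lambda>n. 1 - G / real n \<le> halted_by M w n) sequentially"
    using eventually_gt_at_top [of 0] by (rule eventually_mono [rotated])
  moreover have "eventually (\<lambda>n. halted_by M w n \<le> 1) sequentially"
    by (simp add: halted_by_def)
  moreover have "(\<lambda>n. 1 - G / real n) \<longlonglongrightarrow> 1 - 0"
    by (intro tendsto_diff tendsto_const lim_const_over_n)
  ultimately show ?thesis
    using tendsto_sandwich [of "\<lambda>n. 1 - G / real n" "halted_by M w" sequentially "\<lambda>_. 1" 1] by simp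
qed

lemma SUP_halted_by: "(SUP n. halted_by M w n) = 1"
proof -
  have "bdd_above (range (halted_by M w))"
    by (intro bdd_aboveI [of _ 1]) (auto simp: halted_by_def)
  from LIMSEQ_incseq_SUP [OF this incseq_halted_by] halted_by_tendsto show ?thesis
    by (rule LIMSEQ_unique)
qed

lemma expected_runtime_le:
  "expected_runtime M w \<le> ennreal (real (length w + 2) / halting_prob w)"
proof -
  \<comment> \<open>Summation by parts, the tail-sum formula for an expectation truncated at
    \<open>m\<close>.\<close>
  have telescope: "(\<Sum>n<m. real (Suc n) * (halted_by M w (Suc n) - halted_by M w n))
      = (\<Sum>n<m. halted_by M w m - halted_by M w n)" for m
    by (induction m) (simp_all add: sum_subtractf algebra_simps)
  have "(\<Sum>n<m. ennreal (real (Suc n) * (halted_by M w (Suc n) - halted_by M w n)))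
      \<le> ennreal (real (length w + 2) / halting_prob w)" for m
  proof -
    have "(\<Sum>n<m. ennreal (real (Suc n) * (halted_by M w (Suc n) - halted_by M w n)))
        = ennreal (\<Sum>n<m. real (Suc n) * (halted_by M w (Suc n) - halted_by M w n))"
      using incseq_SucD [OF incseq_halted_by] by (intro sum_ennreal mult_nonneg_nonneg) simp_all
    also have "\<dots> \<le> ennreal (\<Sum>n<m. 1 - halted_by M w n)"
      unfolding telescope by (intro ennreal_leI sum_mono) (simp add: halted_by_def)
    also have "\<dots> \<le> ennreal (real (length w + 2) / halting_prob w)"
      by (intro ennreal_leI sum_unhalted_le)
    finally show ?thesis .
  qed
  then have "(\<Sum>n. ennreal (real (Suc n) * (halted_by M w (Suc n) - halted_by M w n)))
      \<le> ennreal (real (length w + 2) / halting_prob w)"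
    by (intro suminf_le_const) auto
  \<comment> \<open>The supremum 1 selects the finite branch of
    \<open>expected_runtime\<close>.\<close>
  then show ?thesis
    by (simp add: expected_runtime_def SUP_halted_by del: of_nat_add of_nat_Suc)
qed

lemma pmf_tendsto_SUP:
  assumes "halted c"
  shows "(\<lambda>n. pmf (config_after M w n) c) \<longlonglongrightarrow> (SUP n. pmf (config_after M w n) c)"
proof (rule LIMSEQ_incseq_SUP)
  show "bdd_above (range (\<lambda>n. pmf (config_after M w n) c))"
    by (intro bdd_aboveI [of _ 1]) (auto simp: pmf_le_1)
  show "incseq (\<lambda>n. pmf (config_after M w n) c)"
    using incseq_prob_halting [of "{c}"] assms by (simp add: measure_pmf_single)
qed

text \<open>This turns an upper bound on one probability into a lower bound on the other.\<close>

lemma accept_prob_add_reject_prob: "accept_prob M w + reject_prob M w = 1"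
proof -
  have "halted_by M w = (\<lambda>n. pmf (config_after M w n) Accepted + pmf (config_after M w n) Rejected)"
    by (rule ext) (simp add: halted_by_def measure_measure_pmf_finite)
  then have "halted_by M w \<longlonglongrightarrow> accept_prob M w + reject_prob M w"
    unfolding accept_prob_def reject_prob_def
    using tendsto_add [OF pmf_tendsto_SUP [of Accepted] pmf_tendsto_SUP [of Rejected]] by simp
  then show ?thesis
    using halted_by_tendsto LIMSEQ_unique by blast
qed

text \<open>The indicator of \<open>c\<close> is dominated by \<open>eventual_prob r w\<close>,
  whose expectation is constant in time.\<close>

lemma pmf_config_after_le:
  assumes "r = Accept \<and> c = Accepted \<or> r = Reject \<and> c = Rejected"
  shows "pmf (config_after M w n) c \<le> final_prob r w / halting_prob w"
proof -
  have "indicator {c} c' \<le> eventual_prob r w c'" if "wf_config c'" for c'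
    using assms that eventual_prob_running_nonneg
    by (cases c') (auto simp: indicator_def simp del: eventual_prob.simps(1) wf_config.simps(1))
  then have "measure_pmf.expectation (config_after M w n) (indicator {c})
      \<le> measure_pmf.expectation (config_after M w n) (eventual_prob r w)"
    by (rule expectation_mono)
  also have "\<dots> = final_prob r w / halting_prob w"
    using assms by (intro expectation_eventual_prob) blast
  finally show ?thesis
    by (simp add: measure_pmf_single)
qed

lemma accept_prob_le: "accept_prob M w \<le> final_prob Accept w / halting_prob w"
  unfolding accept_prob_def by (rule cSUP_least) (simp_all add: pmf_config_after_le)

lemma reject_prob_le: "reject_prob M w \<le> final_prob Reject w / halting_prob w"
  unfolding reject_prob_def by (rule cSUP_least) (simp_all add: pmf_config_after_le)

lemma reject_prob_nonneg: "0 \<le> reject_prob M w"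
  using LIMSEQ_le_const [OF pmf_tendsto_SUP [of Rejected]] by (auto simp: reject_prob_def)

end

end

section \<open>The automaton\<close>

text \<open>States 0 to 3 hold the entries of a \<open>2 \<times> 2\<close> matrix which is multiplied by the matrix of each letter
  read. State 4 keeps an amplitude which shrinks at the same rate. At the right end-marker the
  antisymmetric part of the matrix goes to the rejecting state 6 and state 4 goes to the accepting
  state 5.\<close>

definition pal_kind :: "15 \<Rightarrow> outcome" where
  "pal_kind q = (if q = 5 then Accept else if q = 6 then Reject
     else if q \<in> {0, 1, 2, 3, 4} then Nonhalting else Restart)"

text \<open>Factors act from right to left. \<open>LeftEnd\<close> splits off state 4, then spreads
  state 0 over the diagonal to form a scaled identity. A letter acts on the columns, held in states
  0, 2 and 1, 3, and leaks from state 4 into 7. \<open>RightEnd\<close> forms the difference and sum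
  of states 1 and 2, then moves every amplitude out of the nonhalting states by quarter
  turns.\<close>

fun pal_op :: "real \<Rightarrow> tape_symbol \<Rightarrow> complex ^ 15 ^ 15" where
  "pal_op \<delta> LeftEnd =
     embed2 0 3 (rotation (1 / sqrt 2) (1 / sqrt 2)) ** embed2 0 4 (rotation (sqrt (1 - \<delta>)) (sqrt \<delta>))"
| "pal_op \<delta> (Letter c) =
     embed2 0 2 ((1 / sqrt 3) *\<^sub>R letter_matrix c) ** embed2 1 3 ((1 / sqrt 3) *\<^sub>R letter_matrix c)
       ** embed2 4 7 (rotation (1 / sqrt 3) (sqrt (2 / 3)))"
| "pal_op \<delta> RightEnd =
     embed2 0 7 (rotation 0 1) ** embed2 2 8 (rotation 0 1) ** embed2 3 9 (rotation 0 1)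
       ** embed2 4 5 (rotation 0 1) ** embed2 1 6 (rotation 0 1)
       ** embed2 1 2 (rotation (1 / sqrt 2) (1 / sqrt 2))"

definition pal_qfa :: "real \<Rightarrow> 15 qfa_restart" where
  "pal_qfa \<delta> = \<lparr>kind = pal_kind, start = 0, op = pal_op \<delta>\<rparr>"

definition pal_state :: "complex ^ 2 ^ 2 \<Rightarrow> complex \<Rightarrow> complex ^ 15" where
  "pal_state X t = (\<chi> q. if q = 0 then X $ 1 $ 1 else if q = 1 then X $ 1 $ 2
     else if q = 2 then X $ 2 $ 1 else if q = 3 then X $ 2 $ 2 else if q = 4 then t else 0)"

lemma pal_qfa_simps [simp]:
  "kind (pal_qfa \<delta>) = pal_kind" "start (pal_qfa \<delta>) = 0" "op (pal_qfa \<delta>) = pal_op \<delta>"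
  by (simp_all add: pal_qfa_def)

lemma unitary_pal_op:
  assumes "0 \<le> \<delta>" "\<delta> \<le> 1"
  shows "unitary (pal_op \<delta> s)"
proof (cases s)
  case LeftEnd
  then show ?thesis
    using assms by (auto intro!: unitary_mult unitary_embed2 unitary_rotation simp: power_divide)
next
  case (Letter c)
  then show ?thesis
    by (auto intro!: unitary_mult unitary_embed2 unitary_rotation letter_matrix_unitary
        simp: power_divide)
next
  case RightEnd
  then show ?thesis
    by (auto intro!: unitary_mult unitary_embed2 unitary_rotation simp: power_divide)
qed

lemma pal_op_LeftEnd:
  "pal_op \<delta> LeftEnd *v basis_state 0
    = pal_state ((sqrt (1 - \<delta>) / sqrt 2) *\<^sub>R mat 1) (of_real (sqrt \<delta>))"
  by (auto simp: vec_eq_iff matrix_vector_mul_assoc [symmetric] embed2_mult_vec basis_state_def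
      axis_def pal_state_def mat_def scaleR_conv_of_real [where 'a = complex])

lemma pal_op_Letter:
  "pal_op \<delta> (Letter c) *v pal_state X t
    = pal_state ((1 / sqrt 3) *\<^sub>R (letter_matrix c ** X)) ((1 / sqrt 3) *\<^sub>R t)
      + axis 7 (of_real (sqrt (2 / 3)) * t)"
proof -
  have "(letter_matrix c ** X) $ i $ j
      = letter_matrix c $ i $ 1 * X $ 1 $ j + letter_matrix c $ i $ 2 * X $ 2 $ j" for i j
    by (simp add: matrix_matrix_mult_def sum_2)
  then show ?thesis
    by (auto simp: vec_eq_iff matrix_vector_mul_assoc [symmetric] embed2_mult_vec
        axis_def pal_state_def scaleR_conv_of_real [where 'a = complex] algebra_simps)
qed

lemma pal_op_RightEnd:
  "pal_op \<delta> RightEnd *v pal_state X t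
    = axis 5 t + axis 6 ((X $ 1 $ 2 - X $ 2 $ 1) / of_real (sqrt 2)) + axis 7 (X $ 1 $ 1)
      + axis 8 ((X $ 1 $ 2 + X $ 2 $ 1) / of_real (sqrt 2)) + axis 9 (X $ 2 $ 2)"
  by (auto simp: vec_eq_iff matrix_vector_mul_assoc [symmetric] embed2_mult_vec
      axis_def pal_state_def field_simps)

section \<open>Outcome probabilities of one round\<close>

lemma pal_state_scaleR: "pal_state (a *\<^sub>R X) (a *\<^sub>R t) = a *\<^sub>R pal_state X t"
  by (simp add: vec_eq_iff pal_state_def)

lemma proj_add: "proj M r (\<psi> + \<phi>) = proj M r \<psi> + proj M r \<phi>"
  by (simp add: vec_eq_iff proj_def)

lemma proj_axis: "proj M r (axis q x) = (if kind M q = r then axis q x else 0)"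
  by (auto simp: vec_eq_iff proj_def axis_def)

lemma proj_pal_state:
  "proj (pal_qfa \<delta>) r (pal_state X t) = (if r = Nonhalting then pal_state X t else 0)"
  by (auto simp: vec_eq_iff proj_def pal_state_def pal_kind_def)

lemma norm_axis: "norm (axis q x) = norm x"
  by (simp add: norm_vec_def L2_set_def axis_def if_distrib [of norm] if_distrib [of "\<lambda>x. x\<^sup>2"] cong: if_cong)

lemma pal_kind_simps [simp]:
  "pal_kind 5 = Accept" "pal_kind 6 = Reject" "pal_kind 7 = Restart" "pal_kind 8 = Restart"
  "pal_kind 9 = Restart" "pal_kind 0 = Nonhalting"
  by (simp_all add: pal_kind_def)

text \<open>Each letter scales the surviving amplitudes by \<open>1 / sqrt 3\<close>, and
  probabilities are quadratic in them. The factor 1/2 comes from the rotation at the right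
  end-marker.\<close>

lemma round_prob_pal_state:
  assumes "r = Accept \<or> r = Reject"
  shows "round_prob (pal_qfa \<delta>) r (pal_state X t) (map Letter w @ [RightEnd]) =
    (if r = Accept then (norm t)\<^sup>2
     else (norm ((word_matrix w ** X) $ 1 $ 2 - (word_matrix w ** X) $ 2 $ 1))\<^sup>2 / 2) / 3 ^ length w"
proof (induction w arbitrary: X)
  case Nil
  show ?case
    using assms
    by (auto simp: pal_op_RightEnd proj_add proj_axis norm_axis norm_divide power_divide
        simp del: pal_op.simps)
next
  case (Cons c w)
  have "round_prob (pal_qfa \<delta>) r (pal_state X t) (map Letter (c # w) @ [RightEnd])
      = (1 / sqrt 3)\<^sup>2 * round_prob (pal_qfa \<delta>) r (pal_state (letter_matrix c ** X) t) (map Letter w @ [RightEnd])"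
    using assms
    by (auto simp: pal_op_Letter proj_add proj_axis proj_pal_state pal_state_scaleR proj_scaleR
        round_prob_scaleR
        simp del: pal_op.simps)
  then show ?case
    by (simp add: Cons.IH matrix_mul_assoc power_divide)
qed

text \<open>Since \<open>pal_state\<close> parametrizes the whole nonhalting subspace,
  \<open>round_ends\<close> can be read off from \<open>pal_op_RightEnd\<close>.\<close>

lemma fixed_by_nonhalting_proj:
  assumes "proj (pal_qfa \<delta>) Nonhalting \<psi> = \<psi>"
  shows "\<psi> = pal_state (vector [vector [\<psi> $ 0, \<psi> $ 1], vector [\<psi> $ 2, \<psi> $ 3]]) (\<psi> $ 4)"
proof -
  have "\<psi> $ q = 0" if "pal_kind q \<noteq> Nonhalting" for q
  proof -
    have "proj (pal_qfa \<delta>) Nonhalting \<psi> $ q = 0"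
      using that by (simp add: proj_def)
    with assms show ?thesis by simp
  qed
  then show ?thesis
    by (auto simp: vec_eq_iff pal_state_def pal_kind_def)
qed

lemma proper_pal_qfa:
  assumes "0 \<le> \<delta>" "\<delta> \<le> 1"
  shows "proper_qfa (pal_qfa \<delta>)"
proof
  fix \<psi>
  assume "proj (pal_qfa \<delta>) Nonhalting \<psi> = \<psi>"
  then obtain X t where "\<psi> = pal_state X t"
    using fixed_by_nonhalting_proj by blast
  then show "proj (pal_qfa \<delta>) Nonhalting (op (pal_qfa \<delta>) RightEnd *v \<psi>) = 0"
    by (simp add: pal_op_RightEnd proj_add proj_axis del: pal_op.simps)
qed (simp_all add: unitary_pal_op [OF assms])

lemma final_prob_pal_qfa:
  assumes "0 \<le> \<delta>" "\<delta> \<le> 1"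
  shows "proper_qfa.final_prob (pal_qfa \<delta>) Accept w = \<delta> / 3 ^ length w"
    "proper_qfa.final_prob (pal_qfa \<delta>) Reject w
      = (1 - \<delta>) / 4 * (norm (asymmetry w))\<^sup>2 / 3 ^ length w"
proof -
  interpret proper_qfa "pal_qfa \<delta>"
    by (rule proper_pal_qfa [OF assms])
  define a where "a = sqrt (1 - \<delta>) / sqrt 2"
  have "final_prob r w = round_prob (pal_qfa \<delta>) r (pal_state (a *\<^sub>R mat 1) (of_real (sqrt \<delta>)))
      (map Letter w @ [RightEnd])" if "r = Accept \<or> r = Reject" for r
    using that
    by (auto simp: final_prob_def tape_def pal_op_LeftEnd proj_pal_state a_def simp del: pal_op.simps)
  moreover have "(word_matrix w ** (a *\<^sub>R mat 1)) $ 1 $ 2 - (word_matrix w ** (a *\<^sub>R mat 1)) $ 2 $ 1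
      = of_real a * asymmetry w"
    by (simp add: matrix_matrix_mult_def sum_2 mat_def asymmetry_def
        scaleR_conv_of_real [where 'a = complex] algebra_simps)
  \<comment> \<open>One factor 1/2 comes from spreading the start amplitude over the diagonal, the
    other from the right end-marker.\<close>
  moreover have "(1 - \<delta>) / 4 = a\<^sup>2 / 2"
    using assms by (simp add: a_def power_divide)
  ultimately show "final_prob Accept w = \<delta> / 3 ^ length w"
    "final_prob Reject w = (1 - \<delta>) / 4 * (norm (asymmetry w))\<^sup>2 / 3 ^ length w"
    using assms by (simp_all only: round_prob_pal_state)
      (simp_all add: norm_mult power_mult_distrib)
qed

theorem theorem22:
  shows "\<exists>C::real. C > 0 \<and>
    (\<forall>\<epsilon>::real. \<epsilon> > 0 \<longrightarrow>
      (\<exists>M :: 15 qfa_restart. valid_qfa M \<and>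
        (\<forall>w. w \<in> L_pal \<longrightarrow> accept_prob M w = 1) \<and>
        (\<forall>w. w \<notin> L_pal \<longrightarrow> reject_prob M w \<ge> 1 - \<epsilon>) \<and>
        (\<forall>w. w \<noteq> [] \<longrightarrow>
          expected_runtime M w
            \<le> ennreal (C * max 1 (1 / \<epsilon>) * 3 ^ length w * real (length w)))))"
proof (intro exI [of _ 12] conjI allI impI)
  fix \<epsilon> :: real
  assume "\<epsilon> > 0"
  \<comment> \<open>Non-palindromes will be accepted with probability at most
    \<open>4 * \<delta>\<close>. The cap at 1 keeps \<delta> a valid probability for large
    \<epsilon> and causes the \<open>max\<close> in the runtime bound.\<close>
  define \<delta> where "\<delta> = min 1 \<epsilon> / 4"
  have \<delta>: "0 < \<delta>" "\<delta> \<le> 1 / 4" "4 * \<delta> \<le> \<epsilon>" "1 / \<delta> = 4 * max 1 (1 / \<epsilon>)"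
    using \<open>\<epsilon> > 0\<close> by (auto simp: \<delta>_def min_def max_def field_simps)
  interpret proper_qfa "pal_qfa \<delta>"
    using \<delta> by (intro proper_pal_qfa) simp_all
  have final: "final_prob Accept w = \<delta> / 3 ^ length w"
    "final_prob Reject w = (1 - \<delta>) / 4 * (norm (asymmetry w))\<^sup>2 / 3 ^ length w" for w
    using \<delta> final_prob_pal_qfa by simp_all
  have halting_ge: "\<delta> / 3 ^ length w \<le> halting_prob w" for w
    using final_prob_nonneg [of Reject w] by (simp add: halting_prob_def final(1))
  have halting_pos: "0 < halting_prob w" for w
    using \<delta> by (intro less_le_trans [OF _ halting_ge]) simp
  show "\<exists>M :: 15 qfa_restart. valid_qfa M \<and>
        (\<forall>w. w \<in> L_pal \<longrightarrow> accept_prob M w = 1) \<and>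
        (\<forall>w. w \<notin> L_pal \<longrightarrow> reject_prob M w \<ge> 1 - \<epsilon>) \<and>
        (\<forall>w. w \<noteq> [] \<longrightarrow>
          expected_runtime M w
            \<le> ennreal (12 * max 1 (1 / \<epsilon>) * 3 ^ length w * real (length w)))"
  proof (intro exI [of _ "pal_qfa \<delta>"] conjI allI impI)
    show "valid_qfa (pal_qfa \<delta>)"
      by (rule valid)
  next
    fix w
    assume "w \<in> L_pal"
    then have "asymmetry w = 0"
      using asymmetry_palindrome by (simp add: L_pal_def)
    then have "final_prob Reject w = 0"
      by (simp add: final)
    then have "reject_prob (pal_qfa \<delta>) w = 0"
      using reject_prob_le [OF halting_pos, of w] reject_prob_nonneg [OF halting_pos, of w] by simp
    then show "accept_prob (pal_qfa \<delta>) w = 1"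
      using accept_prob_add_reject_prob [OF halting_pos, of w] by simp
  next
    fix w
    assume "w \<notin> L_pal"
    then have "1 \<le> norm (asymmetry w)"
      using norm_asymmetry_ge_1 by (simp add: L_pal_def)
    then have "1 \<le> (norm (asymmetry w))\<^sup>2"
      by simp
    then have "(1 - \<delta>) / 4 * 1 \<le> (1 - \<delta>) / 4 * (norm (asymmetry w))\<^sup>2"
      using \<delta> by (intro mult_left_mono) simp_all
    \<comment> \<open>Indeed \<delta> + (1 - \<delta>) / 4 is at least 1/4, so a round halts with
      probability at least 1/4 over \<open>3 ^ length w\<close>.\<close>
    then have "1 / 4 \<le> \<delta> + (1 - \<delta>) / 4 * (norm (asymmetry w))\<^sup>2"
      using \<delta> by simp
    then have "(1 / 4) / 3 ^ length w \<le> halting_prob w"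
      unfolding halting_prob_def final add_divide_distrib [symmetric] by (intro divide_right_mono) simp_all
    then have "final_prob Accept w / halting_prob w \<le> final_prob Accept w / ((1 / 4) / 3 ^ length w)"
      by (intro divide_left_mono mult_pos_pos halting_pos final_prob_nonneg) simp_all
    also have "\<dots> = 4 * \<delta>"
      by (simp add: final)
    finally have "accept_prob (pal_qfa \<delta>) w \<le> \<epsilon>"
      using accept_prob_le [OF halting_pos, of w] \<delta>(3) by simp
    then show "reject_prob (pal_qfa \<delta>) w \<ge> 1 - \<epsilon>"
      using accept_prob_add_reject_prob [OF halting_pos, of w] by simp
  next
    fix w :: "letter list"
    assume "w \<noteq> []"
    then have "1 \<le> length w"
      by (cases w) simp_all
    \<comment> \<open>For nonempty words the tape length is at most three times the word length;
      with \<open>1 / \<delta> = 4 * max 1 (1 / \<epsilon>)\<close> this gives the constant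
      12.\<close>
    have "real (length w + 2) / halting_prob w \<le> (3 * real (length w)) / (\<delta> / 3 ^ length w)"
      using \<open>1 \<le> length w\<close> \<delta>(1) halting_ge by (intro frac_le) simp_all
    also have "\<dots> = 3 * (1 / \<delta>) * 3 ^ length w * real (length w)"
      by simp
    also have "\<dots> = 12 * max 1 (1 / \<epsilon>) * 3 ^ length w * real (length w)"
      unfolding \<delta>(4) by simp
    finally show "expected_runtime (pal_qfa \<delta>) w
        \<le> ennreal (12 * max 1 (1 / \<epsilon>) * 3 ^ length w * real (length w))"
      by (intro order_trans [OF expected_runtime_le [OF halting_pos]] ennreal_leI)
  qed
qed simp

end
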